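(* Let $f(x)\in\mathbb{Z}[x]$ be monic and separable of degree $n$, let $c\in\mathbb{Z}$, and let $F(x)=x^n f\left(x+\frac1x+c\right)$. Then $$\mathrm{disc}(F)=f(c+2)\,f(c-2)\,\mathrm{disc}(f)^2.$$
   Context: For a monic polynomial $p\in\mathbb{Z}[x]$ of degree $m$ with complex roots $\alpha_1,\dots,\alpha_m$ (listed with multiplicity), $\mathrm{disc}(p)=\prod_{1\le i<j\le m}(\alpha_i-\alpha_j)^2$. $F$ is a monic polynomial in $\mathbb{Z}[x]$ of degree $2n$. *)

theory Defs
  imports "HOL-Computational_Algebra.Computational_Algebra"
begin

text \<open>Discriminant of a monic integer polynomial as the product over its complex roots, listed
  with multiplicity in some order; by \<open>disc_eq\<close> below, the order does not matter.
  There is no factor for the leading coefficient, so this is the usual discriminant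
  only for monic polynomials.\<close>

definition complex_roots :: "int poly \<Rightarrow> complex list" where
  "complex_roots p = (SOME as. mset as = proots (map_poly of_int p))"

definition pair_prod :: "complex list \<Rightarrow> complex" where
  "pair_prod as = (\<Prod>j<length as. \<Prod>i<j. (as ! i - as ! j)\<^sup>2)"

definition disc :: "int poly \<Rightarrow> complex" where
  "disc p = pair_prod (complex_roots p)"

text \<open>Separability over \<open>\<rat>\<close>: no repeated root in the algebraically closed field \<open>\<complex>\<close>.\<close>

definition separable :: "int poly \<Rightarrow> bool" where
  "separable p \<longleftrightarrow> rsquarefree (map_poly of_int p :: complex poly)"

text \<open>The indeterminate \<open>x\<close> and the value \<open>f(r)\<close>, both in the field of fractions of \<open>\<int>[x]\<close>.\<close>

definition X :: "int poly fract" where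
  "X = to_fract [:0, 1:]"

definition subst_fract :: "int poly \<Rightarrow> int poly fract \<Rightarrow> int poly fract" where
  "subst_fract f r = poly (map_poly of_int f) r"

lemma mset_complex_roots: "mset (complex_roots p) = proots (map_poly of_int p)"
  unfolding complex_roots_def by (rule someI_ex) (rule ex_mset)

lemma pair_prod_Nil: "pair_prod [] = 1"
  by (simp add: pair_prod_def)

lemma pair_prod_Cons: "pair_prod (x # xs) = (\<Prod>y\<leftarrow>xs. (x - y)\<^sup>2) * pair_prod xs"
proof -
  have "pair_prod (x # xs) = (\<Prod>j<length xs. (x - xs ! j)\<^sup>2 * (\<Prod>i<j. (xs ! i - xs ! j)\<^sup>2))"
    by (simp add: pair_prod_def prod.lessThan_Suc_shift del: prod.lessThan_Suc)
  also have "\<dots> = (\<Prod>j<length xs. (x - xs ! j)\<^sup>2) * pair_prod xs"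
    by (simp add: pair_prod_def prod.distrib)
  also have "(\<Prod>j<length xs. (x - xs ! j)\<^sup>2) = (\<Prod>y\<leftarrow>xs. (x - y)\<^sup>2)"
    by (simp add: prod.list_conv_set_nth atLeast0LessThan)
  finally show ?thesis .
qed

lemma pair_prod_move: "pair_prod (xs @ x # ys) = pair_prod (x # xs @ ys)"
  by (induction xs) (simp_all add: pair_prod_Cons power2_commute[of x] mult_ac)

lemma pair_prod_cong_mset: "mset as = mset bs \<Longrightarrow> pair_prod as = pair_prod bs"
proof (induction as arbitrary: bs)
  case (Cons a as)
  have "a \<in> set bs" using Cons.prems by (metis list.set_intros(1) set_mset_mset)
  then obtain us vs where bs: "bs = us @ a # vs" by (meson split_list)
  have m: "mset as = mset (us @ vs)" using Cons.prems bs by simp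
  have "(\<Prod>y\<leftarrow>as. (a - y)\<^sup>2) = (\<Prod>y\<leftarrow>us @ vs. (a - y)\<^sup>2)"
    using m by (metis mset_map prod_mset_prod_list)
  then show ?case
    using Cons.IH[OF m] by (simp add: bs pair_prod_move pair_prod_Cons)
qed simp

lemma disc_eq:
  assumes "map_poly of_int p = (\<Prod>a\<leftarrow>as. [:- a, 1:])"
  shows "disc p = (\<Prod>j<length as. \<Prod>i<j. (as ! i - as ! j)\<^sup>2)"
proof -
  have "proots (\<Prod>a\<leftarrow>as. [:- a, 1:]) = mset as"
  proof (induction as)
    case (Cons a as)
    have "(\<Prod>b\<leftarrow>as. [:- b, 1:]) \<noteq> (0 :: complex poly)"
      by (auto simp: prod_list_zero_iff)
    then have "proots ([:- a, 1:] * (\<Prod>b\<leftarrow>as. [:- b, 1:])) =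
        proots [:- a, 1:] + proots (\<Prod>b\<leftarrow>as. [:- b, 1:])"
      by (intro proots_mult) simp_all
    with Cons.IH show ?case
      by (simp del: mult_pCons_left)
  qed simp
  then have "mset (complex_roots p) = mset as"
    by (simp add: mset_complex_roots assms)
  then show ?thesis
    unfolding disc_def pair_prod_def[symmetric] by (rule pair_prod_cong_mset)
qed

text \<open>The rational function \<open>x\<^sup>n f(x + 1/x + c)\<close> with \<open>n = deg f\<close> is a polynomial.\<close>

lemma to_fract_of_int: "to_fract (of_int a) = of_int a"
proof -
  have "to_fract (of_nat m) = of_nat m" for m :: nat
    by (induction m) simp_all
  then show ?thesis
    by (cases a rule: int_cases2) simp_all
qed

lemma to_fract_sum: "to_fract (sum g A) = (\<Sum>a\<in>A. to_fract (g a))"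
  by (induction A rule: infinite_finite_induct) simp_all

lemma to_fract_power: "to_fract (a ^ k) = to_fract a ^ k"
  by (induction k) simp_all

lemma X_nonzero: "X \<noteq> 0"
  by (simp add: X_def)

lemma reciprocal_substitution_polynomial:
  "\<exists>!F. to_fract F = X ^ degree f * subst_fract f (X + 1 / X + of_int c)"
proof (rule ex_ex1I)
  let ?n = "degree f"
  define Q where "Q = X * X + of_int c * X + 1"
  let ?F = "\<Sum>k\<le>?n. of_int (coeff f k) * ([:0, 1:] ^ (?n - k) *
    ([:0, 1:] * [:0, 1:] + of_int c * [:0, 1:] + 1) ^ k) :: int poly"
  have "to_fract ?F = (\<Sum>k\<le>?n. of_int (coeff f k) * (X ^ (?n - k) * Q ^ k))"
    by (simp only: to_fract_sum to_fract_mult to_fract_add to_fract_power to_fract_of_int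
        to_fract_1 X_def[symmetric] Q_def)
  also have "\<dots> = (\<Sum>k\<le>?n. X ^ ?n * (of_int (coeff f k) * (X + 1 / X + of_int c) ^ k))"
  proof (rule sum.cong[OF refl])
    fix k assume "k \<in> {..?n}"
    then have "X ^ ?n = X ^ (?n - k) * X ^ k" by (simp flip: power_add)
    moreover have "Q = X * (X + 1 / X + of_int c)"
      using X_nonzero by (simp add: Q_def field_simps)
    ultimately show "of_int (coeff f k) * (X ^ (?n - k) * Q ^ k) =
        X ^ ?n * (of_int (coeff f k) * (X + 1 / X + of_int c) ^ k)"
      by (simp add: power_mult_distrib mult_ac)
  qed
  also have "\<dots> = X ^ ?n * subst_fract f (X + 1 / X + of_int c)"
  proof -
    have "degree (map_poly of_int f :: int poly fract poly) \<le> ?n"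
      by (intro degree_le) (simp add: coeff_map_poly coeff_eq_0)
    then have "subst_fract f r = (\<Sum>k\<le>?n. of_int (coeff f k) * r ^ k)" for r
      unfolding subst_fract_def poly_altdef
      by (intro sum.mono_neutral_cong_left) (auto simp: coeff_map_poly intro!: le_degree)
    then show ?thesis by (simp add: sum_distrib_left)
  qed
  finally show "\<exists>F. to_fract F = X ^ ?n * subst_fract f (X + 1 / X + of_int c)" by blast
qed (metis to_fract_eq_iff)

end

theory Submission
  imports Defs
begin

text \<open>
  Over \<open>\<complex>\<close>, a root \<open>a\<close> of \<open>f\<close> contributes to \<open>F\<close> the factor
  \<open>x (x + 1/x + c - a) = x\<^sup>2 - (a - c) x + 1\<close>. Its roots \<open>u\<^sub>a\<close>, \<open>v\<^sub>a\<close> satisfy \<open>u\<^sub>a v\<^sub>a = 1\<close> and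
  \<open>u\<^sub>a + v\<^sub>a = a - c\<close>, and the discriminant of \<open>F\<close> is a product over pairs taken from these roots.
  There are two kinds of pairs.

  The two roots over the same \<open>a\<close> give \<open>(u\<^sub>a - v\<^sub>a)\<^sup>2 = (a - c)\<^sup>2 - 4 = (c + 2 - a) (c - 2 - a)\<close>;
  the product over all \<open>a\<close> is \<open>f(c + 2) f(c - 2)\<close>.

  The four pairs of roots over distinct entries \<open>a\<close>, \<open>b\<close> of the root list of \<open>f\<close> give the square
  of the resultant of two reciprocal quadratics, which is
  \<open>(u\<^sub>a - u\<^sub>b) (v\<^sub>a - u\<^sub>b) (u\<^sub>a - v\<^sub>b) (v\<^sub>a - v\<^sub>b) = (a - b)\<^sup>2\<close> (\<open>reciprocal_quadratics_resultant\<close>).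
  Hence they contribute \<open>(a - b)\<^sup>4\<close>, the square of what \<open>a\<close>, \<open>b\<close> contribute to the discriminant
  of \<open>f\<close>. The lemma \<open>pair_prod_reciprocal_pairs\<close> collects both kinds.

  The hypothesis on \<open>F\<close> is an identity of rational functions over \<open>\<int>\<close>. It is carried over to \<open>\<complex>\<close>
  by evaluating it at nonzero complex numbers, and this determines the polynomial.
\<close>

lemma poly_of_int_add:
  "poly (map_poly of_int (p + q)) z =
    poly (map_poly of_int p) z + poly (map_poly of_int q) (z :: 'a :: comm_ring_1)"
proof -
  have "map_poly of_int (p + q) = (map_poly of_int p + map_poly of_int q :: 'a poly)"
    by (rule poly_eqI) (simp add: coeff_map_poly)
  then show ?thesis by simp
qed

lemma poly_of_int_mult:
  "poly (map_poly of_int (p * q)) z =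
    poly (map_poly of_int p) z * poly (map_poly of_int q) (z :: 'a :: comm_ring_1)"
  by (induction p)
    (simp_all add: mult_pCons_left poly_of_int_add map_poly_smult map_poly_pCons algebra_simps)

lemma poly_of_int_of_int:
  "poly (map_poly of_int p) (of_int a :: 'a :: comm_ring_1) = of_int (poly p a)"
  by (induction p) (simp_all add: map_poly_pCons)

text \<open>Allowing any exponent \<open>n \<ge> deg f\<close> makes the statement inductive along Horner's scheme:
  for \<open>f = a + x g\<close>, the polynomial for \<open>f\<close> and \<open>n + 1\<close> is \<open>a x\<^sup>n\<^sup>+\<^sup>1 + (x\<^sup>2 + c x + 1) G\<close>, where \<open>G\<close>
  is the polynomial for \<open>g\<close> and \<open>n\<close>.\<close>

lemma reciprocal_substitution_with_values:
  assumes "degree f \<le> n"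
  shows "\<exists>F. to_fract F = X ^ n * subst_fract f (X + 1 / X + of_int c) \<and>
    (\<forall>z :: 'a :: field. z \<noteq> 0 \<longrightarrow> poly (map_poly of_int F) z =
      z ^ n * poly (map_poly of_int f) (z + 1 / z + of_int c))"
  using assms
proof (induction f arbitrary: n)
  case 0
  show ?case by (intro exI[of _ 0]) (simp add: subst_fract_def)
next
  case (pCons a g)
  have const: "to_fract [:b:] = of_int b" for b :: int
    by (metis of_int_poly of_int_eq_id id_apply to_fract_of_int)
  have monom: "poly (map_poly of_int (monom 1 k)) z = z ^ k" for z :: 'a and k
    by (simp add: map_poly_monom poly_monom)
  have fract_monom: "to_fract (monom 1 k) = X ^ k" for k
    by (simp add: X_def monom_altdef to_fract_power)
  show ?case
  proof (cases "g = 0")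
    case True
    show ?thesis
    proof (intro exI[of _ "[:a:] * monom 1 n"] conjI allI impI)
      show "to_fract ([:a:] * monom 1 n) =
          X ^ n * subst_fract (pCons a g) (X + 1 / X + of_int c)"
        unfolding to_fract_mult const fract_monom
        by (simp add: True subst_fract_def map_poly_pCons)
      show "poly (map_poly of_int ([:a:] * monom 1 n)) z =
          z ^ n * poly (map_poly of_int (pCons a g)) (z + 1 / z + of_int c)" for z :: 'a
        unfolding poly_of_int_mult monom by (simp add: True map_poly_pCons)
    qed
  next
    case False
    then obtain m where n: "n = Suc m" and m: "degree g \<le> m"
      using pCons.prems by (cases n) simp_all
    obtain G where G: "to_fract G = X ^ m * subst_fract g (X + 1 / X + of_int c)"
      and G_values: "\<And>z :: 'a. z \<noteq> 0 \<Longrightarrow> poly (map_poly of_int G) z =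
        z ^ m * poly (map_poly of_int g) (z + 1 / z + of_int c)"
      using pCons.IH[OF m] by blast
    let ?F = "[:a:] * monom 1 n + (monom 1 2 + [:c:] * monom 1 1 + 1) * G"
    show ?thesis
    proof (intro exI[of _ ?F] conjI allI impI)
      show "to_fract ?F = X ^ n * subst_fract (pCons a g) (X + 1 / X + of_int c)"
        unfolding to_fract_mult to_fract_add const fract_monom G to_fract_1 n
        using X_nonzero
        by (simp add: subst_fract_def map_poly_pCons field_simps power2_eq_square)
      show "poly (map_poly of_int ?F) z =
          z ^ n * poly (map_poly of_int (pCons a g)) (z + 1 / z + of_int c)"
        if "z \<noteq> 0" for z :: 'a
        unfolding poly_of_int_mult poly_of_int_add monom G_values[OF that] n
        using that by (simp add: map_poly_pCons field_simps power2_eq_square)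
    qed
  qed
qed

lemma reciprocal_substitution_values:
  fixes z :: "'a :: field"
  assumes "to_fract F = X ^ degree f * subst_fract f (X + 1 / X + of_int c)" and "z \<noteq> 0"
  shows "poly (map_poly of_int F) z =
    z ^ degree f * poly (map_poly of_int f) (z + 1 / z + of_int c)"
  using reciprocal_substitution_with_values[of f "degree f" c, where 'a = 'a] assms
  by (metis order_refl to_fract_eq_iff)

lemma poly_eq_if_eq_on_nonzero:
  fixes p q :: "'a :: {idom, ring_char_0} poly"
  assumes "\<And>z. z \<noteq> 0 \<Longrightarrow> poly p z = poly q z"
  shows "p = q"
proof -
  \<comment> \<open>After multiplication by \<open>x\<close>, both sides also agree at \<open>0\<close>.\<close>
  have "pCons 0 p = pCons 0 q"
    by (rule poly_eq_poly_eq_iff[THEN iffD1]) (use assms in \<open>auto simp: fun_eq_iff\<close>)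
  then show ?thesis by simp
qed

lemma monic_eq_prod_complex_roots:
  assumes "lead_coeff p = 1"
  shows "map_poly of_int p = (\<Prod>a\<leftarrow>complex_roots p. [:- a, 1:])"
proof -
  let ?p = "map_poly of_int p :: complex poly"
  have "lead_coeff ?p = 1"
    using assms by (simp add: coeff_map_poly degree_map_poly)
  then have "?p = (\<Prod>a\<in>#proots ?p. [:- a, 1:])"
    using complex_poly_decompose_multiset[of ?p] by simp
  also have "\<dots> = (\<Prod>a\<leftarrow>complex_roots p. [:- a, 1:])"
    by (simp flip: mset_complex_roots prod_mset_prod_list)
  finally show ?thesis .
qed

lemma poly_prod_list_linear: "poly (\<Prod>a\<leftarrow>as. [:- a, 1:]) x = (\<Prod>a\<leftarrow>as. x - a)"
  for x :: "'a :: comm_ring_1"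
  by (induction as) (simp_all add: algebra_simps)

lemma exists_complex_prod_sum: "\<exists>u v :: complex. u * v = p \<and> u + v = s"
proof (intro exI conjI)
  let ?d = "csqrt (s\<^sup>2 - 4 * p)"
  have "(s + ?d) / 2 * ((s - ?d) / 2) = (s\<^sup>2 - ?d\<^sup>2) / 4"
    by (simp add: field_simps power2_eq_square)
  then show "(s + ?d) / 2 * ((s - ?d) / 2) = p" by simp
  show "(s + ?d) / 2 + (s - ?d) / 2 = s" by (simp add: field_simps)
qed

text \<open>Since \<open>s t = 1\<close>, the number \<open>s\<^sup>2 - (u + v) s + 1\<close> equals \<open>s (s + t - (u + v))\<close>, and likewise
  for \<open>t\<close>; the factors \<open>s\<close> and \<open>t\<close> cancel in the product.\<close>

lemma reciprocal_quadratics_resultant: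
  fixes u v s t :: "'a :: comm_ring_1"
  assumes "u * v = 1" and "s * t = 1"
  shows "(u - s) * (v - s) * ((u - t) * (v - t)) = (u + v - (s + t))\<^sup>2"
proof -
  have "(u - s) * (v - s) = s * (s + t - (u + v))"
    using assms by (simp add: algebra_simps)
  moreover have "(u - t) * (v - t) = t * (s + t - (u + v))"
    using assms by (simp add: algebra_simps)
  ultimately have "(u - s) * (v - s) * ((u - t) * (v - t)) = s * t * (s + t - (u + v))\<^sup>2"
    by (simp add: power2_eq_square mult_ac)
  then show ?thesis by (simp add: assms power2_commute)
qed

lemma prod_list_mult: "(\<Prod>x\<leftarrow>xs. f x * g x) = (\<Prod>x\<leftarrow>xs. f x) * (\<Prod>x\<leftarrow>xs. g x)"
  for f g :: "'b \<Rightarrow> 'a :: comm_monoid_mult"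
  by (induction xs) (simp_all add: mult_ac)

lemma prod_list_concat_pairs:
  "(\<Prod>y\<leftarrow>concat (map (\<lambda>a. [u a, v a]) as). h y) = (\<Prod>a\<leftarrow>as. h (u a) * h (v a))"
  for h :: "'b \<Rightarrow> 'a :: comm_monoid_mult"
  by (induction as) (simp_all add: mult_ac)

lemma pair_prod_reciprocal_pairs:
  assumes uv: "\<And>a. u a * v a = 1" and sum: "\<And>a. u a + v a = a - c"
  shows "pair_prod (concat (map (\<lambda>a. [u a, v a]) as)) =
    (\<Prod>a\<leftarrow>as. (a - c)\<^sup>2 - 4) * (pair_prod as)\<^sup>2"
proof (induction as)
  case Nil
  show ?case by (simp add: pair_prod_Nil)
next
  case (Cons a as)
  let ?L = "concat (map (\<lambda>a. [u a, v a]) as)"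
  have same: "(u a - v a)\<^sup>2 = (a - c)\<^sup>2 - 4"
  proof -
    have "(u a - v a)\<^sup>2 = (u a + v a)\<^sup>2 - 4 * (u a * v a)"
      by (simp add: power2_eq_square algebra_simps)
    then show ?thesis by (simp add: uv sum)
  qed
  have across: "(u a - u b)\<^sup>2 * (u a - v b)\<^sup>2 * ((v a - u b)\<^sup>2 * (v a - v b)\<^sup>2) =
      ((a - b)\<^sup>2)\<^sup>2" for b
  proof -
    have "(u a - u b) * (u a - v b) * ((v a - u b) * (v a - v b)) = (a - b)\<^sup>2"
      using reciprocal_quadratics_resultant[OF uv uv, of a b] by (simp add: sum mult_ac)
    then show ?thesis by (simp only: flip: power_mult_distrib)
  qed
  have "(\<Prod>y\<leftarrow>?L. (u a - y)\<^sup>2) * (\<Prod>y\<leftarrow>?L. (v a - y)\<^sup>2) = (\<Prod>b\<leftarrow>as. ((a - b)\<^sup>2)\<^sup>2)"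
    by (simp only: prod_list_concat_pairs across flip: prod_list_mult)
  also have "\<dots> = (\<Prod>b\<leftarrow>as. (a - b)\<^sup>2)\<^sup>2"
    by (simp add: power2_eq_square prod_list_mult)
  finally have "pair_prod (u a # v a # ?L) =
      (u a - v a)\<^sup>2 * (\<Prod>b\<leftarrow>as. (a - b)\<^sup>2)\<^sup>2 * pair_prod ?L"
    by (simp add: pair_prod_Cons mult_ac)
  then show ?case
    by (simp add: same Cons.IH pair_prod_Cons power_mult_distrib mult_ac)
qed

theorem theorem4p5:
  fixes f F :: "int poly" and c :: int and n :: nat
  assumes "lead_coeff f = 1"
    and "separable f"
    and "degree f = n"
    and "to_fract F = X ^ n * subst_fract f (X + 1 / X + of_int c)"
  shows "disc F = of_int (poly f (c + 2)) * of_int (poly f (c - 2)) * (disc f)\<^sup>2"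
proof -
  let ?as = "complex_roots f"
  let ?c = "of_int c :: complex"
  have f: "map_poly of_int f = (\<Prod>a\<leftarrow>?as. [:- a, 1:])"
    using assms(1) by (rule monic_eq_prod_complex_roots)
  have f_value: "poly (map_poly of_int f) x = (\<Prod>a\<leftarrow>?as. x - a)" for x
    by (simp add: f poly_prod_list_linear)
  have n: "n = length ?as"
    using size_proots_complex[of "map_poly of_int f"] assms(3)
    by (simp add: degree_map_poly flip: mset_complex_roots)
  have "\<forall>a. \<exists>s t. s * t = 1 \<and> s + t = a - ?c"
    using exists_complex_prod_sum by blast
  then obtain u v where uv: "\<And>a. u a * v a = 1" and sum: "\<And>a. u a + v a = a - ?c"
    by metis
  let ?L = "concat (map (\<lambda>a. [u a, v a]) ?as)"
  have "map_poly of_int F = (\<Prod>y\<leftarrow>?L. [:- y, 1:])"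
  proof (rule poly_eq_if_eq_on_nonzero)
    fix z :: complex
    assume z: "z \<noteq> 0"
    have factor: "(z - u a) * (z - v a) = z * (z + 1 / z + ?c - a)" for a
    proof -
      have "(z - u a) * (z - v a) = z * z - (u a + v a) * z + u a * v a"
        by (simp add: algebra_simps)
      then show ?thesis using z by (simp add: uv sum field_simps)
    qed
    have "poly (map_poly of_int F) z = z ^ n * (\<Prod>a\<leftarrow>?as. z + 1 / z + ?c - a)"
      using reciprocal_substitution_values[of F f c z] assms(3,4) z by (simp add: f_value)
    also have "\<dots> = (\<Prod>a\<leftarrow>?as. z * (z + 1 / z + ?c - a))"
      by (simp add: n prod_list_mult map_replicate_const prod_list_replicate)
    also have "\<dots> = poly (\<Prod>y\<leftarrow>?L. [:- y, 1:]) z"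
      unfolding poly_prod_list_linear by (simp only: prod_list_concat_pairs factor)
    finally show "poly (map_poly of_int F) z = poly (\<Prod>y\<leftarrow>?L. [:- y, 1:]) z" .
  qed
  then have "disc F = pair_prod ?L"
    by (simp add: disc_eq pair_prod_def)
  also have "\<dots> = (\<Prod>a\<leftarrow>?as. (a - ?c)\<^sup>2 - 4) * (disc f)\<^sup>2"
    by (simp add: pair_prod_reciprocal_pairs[OF uv sum] disc_def)
  also have "(\<Prod>a\<leftarrow>?as. (a - ?c)\<^sup>2 - 4) = (\<Prod>a\<leftarrow>?as. (of_int (c + 2) - a) * (of_int (c - 2) - a))"
    by (simp add: power2_eq_square algebra_simps)
  also have "\<dots> = of_int (poly f (c + 2)) * of_int (poly f (c - 2))"
    by (simp only: prod_list_mult flip: f_value poly_of_int_of_int)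
  finally show ?thesis .
qed

end
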